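(* Let $v$ be an almost polyadicly continuous sequence of elements of $[0,1]$. Then $v$ is Buck uniformly distributed if and only if $v$ is uniformly distributed.
   Context: For $m\in\mathbb N$, $r\ge 0$ let $r+(m)=\{n\in\mathbb N: n\equiv r\pmod m\}$. Buck's measure density of $A\subset\mathbb N$ is $\mu^\ast(A)=\inf\{\sum_{j=1}^k\frac1{m_j}: A\subset\bigcup_{j=1}^k(r_j+(m_j))\}$; $A$ is Buck measurable if $\mu^\ast(A)+\mu^\ast(\mathbb N\setminus A)=1$, and $\mu=\mu^\ast$ on Buck measurable sets. A sequence $v$ is polyadicly continuous on $A\subset\mathbb N$ if for every $\varepsilon>0$ there is $m\in\mathbb N$ with $|v(n_1)-v(n_2)|<\varepsilon$ whenever $n_1,n_2\in A$, $n_1\equiv n_2\pmod m$. $v$ is almost polyadicly continuous if for every $\delta>0$ there is a Buck measurable $B$ with $\mu(B)\le\delta$ such that $v$ is polyadicly continuous on $\mathbb N\setminus B$. A sequence $v$ in $[0,1]$ is uniformly distributed if $\lim_{N\to\infty}\frac1N|\{n\le N: v(n)<x\}|=x$ for all $x\in[0,1]$; it is Buck uniformly distributed if for every $x\in[0,1]$ the set $\{n\in\mathbb N: v(n)<x\}$ is Buck measurable and has Buck measure $x$. *)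

theory Defs
  imports Complex_Main "HOL-Number_Theory.Cong"
begin

text \<open>
  The natural numbers start at 1, so subsets of the naturals are subsets of \<open>{1..} :: nat set\<close>
  and complements are taken in \<open>{1..}\<close>.  A sequence is a function on \<open>nat\<close> whose value at 0 is
  never used.
\<close>

definition arith_prog :: "nat \<Rightarrow> nat \<Rightarrow> nat set" where
  "arith_prog r m = {n \<in> {1..}. [n = r] (mod m)}"

definition buck_measure_density :: "nat set \<Rightarrow> real" where
  "buck_measure_density A =
     Inf {(\<Sum>j=1..k. 1 / real (m j)) | (k::nat) (m :: nat \<Rightarrow> nat) (r :: nat \<Rightarrow> nat).
            k \<ge> 1 \<and> (\<forall>j\<in>{1..k}. m j \<ge> 1) \<and> A \<subseteq> (\<Union>j\<in>{1..k}. arith_prog (r j) (m j))}"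

definition buck_measurable :: "nat set \<Rightarrow> bool" where
  "buck_measurable A \<longleftrightarrow>
     A \<subseteq> {1..} \<and> buck_measure_density A + buck_measure_density ({1..} - A) = 1"

text \<open>Only meaningful for sets satisfying \<^const>\<open>buck_measurable\<close>.\<close>

abbreviation buck_measure :: "nat set \<Rightarrow> real" where
  "buck_measure A \<equiv> buck_measure_density A"

definition polyadicly_continuous_on :: "nat set \<Rightarrow> (nat \<Rightarrow> real) \<Rightarrow> bool" where
  "polyadicly_continuous_on A v \<longleftrightarrow>
     (\<forall>\<epsilon>>0. \<exists>m\<ge>1. \<forall>n\<^sub>1\<in>A. \<forall>n\<^sub>2\<in>A. [n\<^sub>1 = n\<^sub>2] (mod m) \<longrightarrow> \<bar>v n\<^sub>1 - v n\<^sub>2\<bar> < \<epsilon>)"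

definition almost_polyadicly_continuous :: "(nat \<Rightarrow> real) \<Rightarrow> bool" where
  "almost_polyadicly_continuous v \<longleftrightarrow>
     (\<forall>\<delta>>0. \<exists>B. buck_measurable B \<and> buck_measure B \<le> \<delta> \<and> polyadicly_continuous_on ({1..} - B) v)"

definition uniformly_distributed :: "(nat \<Rightarrow> real) \<Rightarrow> bool" where
  "uniformly_distributed v \<longleftrightarrow>
     (\<forall>x\<in>{0..1}. (\<lambda>N. real (card {n \<in> {1..N}. v n < x}) / real N) \<longlonglongrightarrow> x)"

definition buck_uniformly_distributed :: "(nat \<Rightarrow> real) \<Rightarrow> bool" where
  "buck_uniformly_distributed v \<longleftrightarrow>
     (\<forall>x\<in>{0..1}. buck_measurable {n \<in> {1..}. v n < x} \<and> buck_measure {n \<in> {1..}. v n < x} = x)"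

end

theory Submission
  imports Defs
begin

text \<open>
  A finite cover by progressions bounds the counting function, so Buck's density dominates the upper
  asymptotic density; applied to a set and to its complement this gives the forward direction.
  Conversely, off an exceptional set \<open>B\<close> of small density and for a modulus \<open>m\<close> of
  \<open>\<epsilon>\<close>-continuity, consider the residue classes modulo \<open>m\<close> which meet \<open>{v < x} - B\<close>.  They
  cover \<open>{v < x} - B\<close>, and on them \<open>v < x + \<epsilon>\<close> outside \<open>B\<close>; hence the proportion of such classes
  is at most \<open>x + \<epsilon>\<close> plus the density of \<open>B\<close>, by uniform distribution.  The set \<open>{v \<ge> x}\<close> is
  treated in the same way, and densities of complementary sets add up to at least 1.
\<close>

section \<open>Finite covers by progressions and elementary properties of Buck's density\<close>

lemma buck_measure_density_le_indexed_cover: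
  fixes k :: nat
  assumes "k \<ge> 1" "\<And>j. j \<in> {1..k} \<Longrightarrow> m j \<ge> 1"
    and "A \<subseteq> (\<Union>j\<in>{1..k}. arith_prog (r j) (m j))"
  shows "buck_measure_density A \<le> (\<Sum>j=1..k. 1 / real (m j))"
  unfolding buck_measure_density_def
proof (rule cInf_lower)
  show "bdd_below {(\<Sum>j=1..k. 1 / real (m j)) | (k::nat) (m :: nat \<Rightarrow> nat) (r :: nat \<Rightarrow> nat).
            k \<ge> 1 \<and> (\<forall>j\<in>{1..k}. m j \<ge> 1) \<and> A \<subseteq> (\<Union>j\<in>{1..k}. arith_prog (r j) (m j))}"
    by (rule bdd_belowI[of _ 0]) (auto intro!: sum_nonneg)
qed (use assms in blast)

lemma buck_measure_density_empty_le: "buck_measure_density {} \<le> 0"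
proof (rule field_le_epsilon)
  fix e :: real assume "e > 0"
  then obtain n where n: "inverse (real (Suc n)) < e" using reals_Archimedean by blast
  have "buck_measure_density {} \<le> (\<Sum>j=1..1::nat. 1 / real (Suc n))"
    by (rule buck_measure_density_le_indexed_cover) auto
  with n show "buck_measure_density {} \<le> 0 + e" by (simp add: inverse_eq_divide)
qed

text \<open>Frees covers from the numbering \<open>1..k\<close>: below they are indexed by sets of
  residues and by disjoint sums. The enumeration \<open>h\<close> of \<open>I\<close> reduces this
  to the definition, except for empty \<open>I\<close>.\<close>

lemma buck_measure_density_le_cover:
  assumes "finite I" "\<And>i. i \<in> I \<Longrightarrow> m i \<ge> 1"
    and cover: "A \<subseteq> (\<Union>i\<in>I. arith_prog (r i) (m i))"
  shows "buck_measure_density A \<le> (\<Sum>i\<in>I. 1 / real (m i))"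
proof (cases "I = {}")
  case True
  with cover buck_measure_density_empty_le show ?thesis by simp
next
  case False
  obtain h where h: "bij_betw h {1..card I} I"
    using ex_bij_betw_nat_finite_1[OF \<open>finite I\<close>] by blast
  then have im: "h ` {1..card I} = I" by (simp add: bij_betw_def)
  have "buck_measure_density A \<le> (\<Sum>j=1..card I. 1 / real (m (h j)))"
  proof (rule buck_measure_density_le_indexed_cover)
    show "card I \<ge> 1" using False \<open>finite I\<close> by (simp add: Suc_le_eq card_gt_0_iff)
    show "m (h j) \<ge> 1" if "j \<in> {1..card I}" for j
    proof -
      from that im have "h j \<in> I" by blast
      then show ?thesis by (rule assms(2))
    qed
    show "A \<subseteq> (\<Union>j\<in>{1..card I}. arith_prog (r (h j)) (m (h j)))"
    proof -
      have "(\<Union>i\<in>h ` {1..card I}. arith_prog (r i) (m i))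
          = (\<Union>j\<in>{1..card I}. arith_prog (r (h j)) (m (h j)))" by (simp only: image_image)
      with cover show ?thesis by (simp only: im)
    qed
  qed
  also have "\<dots> = (\<Sum>i\<in>I. 1 / real (m i))" by (rule sum.reindex_bij_betw[OF h])
  finally show ?thesis .
qed

lemma buck_measure_density_less_cover:
  assumes "A \<subseteq> {1..}" "buck_measure_density A < c"
  obtains k :: nat and m r where "\<And>j. j \<in> {1..k} \<Longrightarrow> m j \<ge> 1"
    "A \<subseteq> (\<Union>j\<in>{1..k}. arith_prog (r j) (m j))" "(\<Sum>j=1..k. 1 / real (m j)) < c"
proof -
  let ?S = "{(\<Sum>j=1..k. 1 / real (m j)) | (k::nat) (m :: nat \<Rightarrow> nat) (r :: nat \<Rightarrow> nat).
      k \<ge> 1 \<and> (\<forall>j\<in>{1..k}. m j \<ge> 1) \<and> A \<subseteq> (\<Union>j\<in>{1..k}. arith_prog (r j) (m j))}"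
  \<comment> \<open>The single class modulo 1 covers everything, so the infimum is taken over a
    nonempty set and can be approximated from inside it.\<close>
  have "(\<Sum>j=1..1::nat. 1 / real 1) \<in> ?S"
    using assms(1) by (intro CollectI exI[of _ 1] exI[of _ "\<lambda>_. 1"] exI[of _ "\<lambda>_. 0"])
      (auto simp: arith_prog_def)
  then have "?S \<noteq> {}" by blast
  from cInf_lessD[OF this assms(2)[unfolded buck_measure_density_def]] that
  show thesis by blast
qed

lemma buck_measure_density_mono:
  assumes "A \<subseteq> B" "B \<subseteq> {1..}"
  shows "buck_measure_density A \<le> buck_measure_density B"
proof (rule dense_ge)
  fix c assume "buck_measure_density B < c"
  from buck_measure_density_less_cover[OF assms(2) this]
  obtain k :: nat and m r where B: "\<And>j. j \<in> {1..k} \<Longrightarrow> m j \<ge> 1"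
    "B \<subseteq> (\<Union>j\<in>{1..k}. arith_prog (r j) (m j))" "(\<Sum>j=1..k. 1 / real (m j)) < c" by blast
  have "buck_measure_density A \<le> (\<Sum>j=1..k. 1 / real (m j))"
    using B assms(1) by (intro buck_measure_density_le_cover) auto
  with B(3) show "buck_measure_density A \<le> c" by simp
qed

text \<open>Near-optimal covers of both sets, each within \<open>e / 2\<close>, are put side by
  side; the disjoint sum of their index sets makes the total cost the sum of the two costs.\<close>

lemma buck_measure_density_Un_le:
  assumes "A \<subseteq> {1..}" "B \<subseteq> {1..}"
  shows "buck_measure_density (A \<union> B) \<le> buck_measure_density A + buck_measure_density B"
proof (rule field_le_epsilon)
  fix e :: real assume "e > 0"
  have "buck_measure_density A < buck_measure_density A + e / 2" using \<open>e > 0\<close> by simp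
  from buck_measure_density_less_cover[OF assms(1) this]
  obtain k :: nat and m r where A: "\<And>j. j \<in> {1..k} \<Longrightarrow> m j \<ge> 1"
    "A \<subseteq> (\<Union>j\<in>{1..k}. arith_prog (r j) (m j))"
    "(\<Sum>j=1..k. 1 / real (m j)) < buck_measure_density A + e / 2" by blast
  have "buck_measure_density B < buck_measure_density B + e / 2" using \<open>e > 0\<close> by simp
  from buck_measure_density_less_cover[OF assms(2) this]
  obtain k' :: nat and m' r' where B: "\<And>j. j \<in> {1..k'} \<Longrightarrow> m' j \<ge> 1"
    "B \<subseteq> (\<Union>j\<in>{1..k'}. arith_prog (r' j) (m' j))"
    "(\<Sum>j=1..k'. 1 / real (m' j)) < buck_measure_density B + e / 2" by blast
  let ?m = "case_sum m m'"
  have "buck_measure_density (A \<union> B) \<le> (\<Sum>i\<in>{1..k} <+> {1..k'}. 1 / real (?m i))"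
  proof (rule buck_measure_density_le_cover)
    show "?m i \<ge> 1" if "i \<in> {1..k} <+> {1..k'}" for i using that A(1) B(1) by auto
    show "A \<union> B \<subseteq> (\<Union>i\<in>{1..k} <+> {1..k'}. arith_prog (case_sum r r' i) (?m i))"
      unfolding Plus_def UN_Un UN_simps(10) sum.case using A(2) B(2) by (rule Un_mono)
  qed simp
  also have "\<dots> = (\<Sum>j=1..k. 1 / real (m j)) + (\<Sum>j=1..k'. 1 / real (m' j))"
    by (simp add: sum.Plus)
  finally show "buck_measure_density (A \<union> B)
      \<le> buck_measure_density A + buck_measure_density B + e" using A(3) B(3) by simp
qed

text \<open>Each residue in \<open>R\<close> contributes one progression of modulus
  \<open>m\<close>, at cost \<open>1 / m\<close>.\<close>

lemma buck_measure_density_le_residues: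
  assumes "m \<ge> 1" "finite R" "A \<subseteq> {1..}" "\<And>n. n \<in> A \<Longrightarrow> n mod m \<in> R"
  shows "buck_measure_density A \<le> real (card R) / real m"
proof -
  have "A \<subseteq> (\<Union>i\<in>R. arith_prog i m)"
  proof
    fix n assume "n \<in> A"
    with assms(3) have "n \<in> arith_prog (n mod m) m" by (auto simp: arith_prog_def cong_def)
    with assms(4)[OF \<open>n \<in> A\<close>] show "n \<in> (\<Union>i\<in>R. arith_prog i m)" by blast
  qed
  with assms(1,2) have "buck_measure_density A \<le> (\<Sum>i\<in>R. 1 / real m)"
    by (intro buck_measure_density_le_cover) auto
  then show ?thesis by simp
qed

section \<open>Comparison with counting functions\<close>

text \<open>Within a residue class the quotient \<open>n div m\<close> determines \<open>n\<close>,
  and for \<open>n \<le> N\<close> it takes at most \<open>N div m + 1\<close> values.\<close>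

lemma card_arith_prog_le:
  assumes "m \<ge> 1"
  shows "real (card (arith_prog r m \<inter> {1..N})) \<le> real N / real m + 1"
proof -
  have "inj_on (\<lambda>n. n div m) (arith_prog r m \<inter> {1..N})"
  proof (rule inj_onI)
    fix a b assume "a \<in> arith_prog r m \<inter> {1..N}" "b \<in> arith_prog r m \<inter> {1..N}" "a div m = b div m"
    then have "a div m * m + a mod m = b div m * m + b mod m"
      by (simp only: arith_prog_def cong_def Int_iff mem_Collect_eq)
    then show "a = b" by (simp only: div_mult_mod_eq)
  qed
  moreover have "(\<lambda>n. n div m) ` (arith_prog r m \<inter> {1..N}) \<subseteq> {0..N div m}"
    by (auto intro: div_le_mono)
  ultimately have "card (arith_prog r m \<inter> {1..N}) \<le> card {0..N div m}"
    by (rule card_inj_on_le) simp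
  then have "real (card (arith_prog r m \<inter> {1..N})) \<le> real (N div m) + 1" by simp
  with of_nat_div_le_of_nat[of N m, where ?'a = real] show ?thesis by linarith
qed

text \<open>A cover of cost \<open>s < c\<close> by \<open>k\<close> progressions gives at most
  \<open>s * N + k\<close> elements up to \<open>N\<close>; the constant \<open>k\<close> is
  absorbed once \<open>N > k / (c - s)\<close>.\<close>

lemma eventually_card_less_buck_measure_density:
  assumes "A \<subseteq> {1..}" "buck_measure_density A < c"
  shows "\<forall>\<^sub>F N in sequentially. real (card (A \<inter> {1..N})) < c * real N"
proof -
  from buck_measure_density_less_cover[OF assms]
  obtain k :: nat and m r where A: "\<And>j. j \<in> {1..k} \<Longrightarrow> m j \<ge> 1"
    "A \<subseteq> (\<Union>j\<in>{1..k}. arith_prog (r j) (m j))"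
    "(\<Sum>j=1..k. 1 / real (m j)) < c" by blast
  define s where "s = (\<Sum>j=1..k. 1 / real (m j))"
  have bound: "real (card (A \<inter> {1..N})) \<le> s * real N + real k" for N
  proof -
    have "card (A \<inter> {1..N}) \<le> card (\<Union>j\<in>{1..k}. arith_prog (r j) (m j) \<inter> {1..N})"
      by (rule card_mono) (use A(2) in auto)
    also have "\<dots> \<le> (\<Sum>j=1..k. card (arith_prog (r j) (m j) \<inter> {1..N}))"
      by (rule card_UN_le) simp
    finally have "real (card (A \<inter> {1..N})) \<le> (\<Sum>j=1..k. real (card (arith_prog (r j) (m j) \<inter> {1..N})))"
      by (metis of_nat_le_iff of_nat_sum)
    also have "\<dots> \<le> (\<Sum>j=1..k. real N / real (m j) + 1)"
      using A(1) by (intro sum_mono card_arith_prog_le)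
    also have "\<dots> = s * real N + real k"
      by (simp add: s_def sum.distrib sum_distrib_right)
    finally show ?thesis .
  qed
  have "s < c" using A(3) by (simp add: s_def)
  have "\<forall>\<^sub>F N in sequentially. real N > real k / (c - s)"
    using filterlim_real_sequentially by (simp add: filterlim_at_top_dense)
  then show ?thesis
  proof eventually_elim
    case (elim N)
    then have "real k < (c - s) * real N"
      using \<open>s < c\<close> by (simp add: pos_divide_less_eq mult.commute)
    with bound[of N] show ?case by (simp add: algebra_simps)
  qed
qed

lemma card_Int_add_card_compl:
  fixes A :: "nat set"
  assumes "A \<subseteq> {1..}"
  shows "real (card (A \<inter> {1..N})) + real (card (({1..} - A) \<inter> {1..N})) = real N"
proof -
  have "card (A \<inter> {1..N}) + card (({1..} - A) \<inter> {1..N}) = card {1..N}"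
    using assms
    by (subst card_Un_disjoint[symmetric]) (auto simp del: card_atLeastAtMost intro: arg_cong[of _ _ card])
  then show ?thesis by (metis card_atLeastAtMost diff_Suc_1 of_nat_add)
qed

text \<open>The counts of a set and of its complement add up to \<open>N\<close>, while each is
  eventually below its density plus \<open>e / 2\<close> times \<open>N\<close>.\<close>

lemma buck_measure_density_compl_ge:
  assumes "A \<subseteq> {1..}"
  shows "1 \<le> buck_measure_density A + buck_measure_density ({1..} - A)"
proof (rule field_le_epsilon)
  fix e :: real assume "e > 0"
  let ?a = "buck_measure_density A" and ?b = "buck_measure_density ({1..} - A)"
  have "\<forall>\<^sub>F N in sequentially. real (card (A \<inter> {1..N})) < (?a + e / 2) * real N"
    using assms \<open>e > 0\<close> by (intro eventually_card_less_buck_measure_density) auto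
  moreover have "\<forall>\<^sub>F N in sequentially. real (card (({1..} - A) \<inter> {1..N})) < (?b + e / 2) * real N"
    using \<open>e > 0\<close> by (intro eventually_card_less_buck_measure_density) auto
  ultimately have "\<forall>\<^sub>F N in sequentially. 1 \<le> ?a + ?b + e"
    using eventually_gt_at_top[of 0]
  proof eventually_elim
    case (elim N)
    then have "1 * real N < (?a + ?b + e) * real N"
      using card_Int_add_card_compl[OF assms, of N] by (simp add: algebra_simps)
    then show ?case using elim(3) by (simp only: mult_less_cancel_right) auto
  qed
  then show "1 \<le> ?a + ?b + e" by simp
qed

text \<open>Since the two densities sum to at least 1, upper bounds \<open>x\<close> and
  \<open>1 - x\<close> must both be attained. Thus only upper estimates are needed for the converse
  direction.\<close>

lemma buck_measure_density_eqI:
  assumes "A \<subseteq> {1..}" "buck_measure_density A \<le> x" "buck_measure_density ({1..} - A) \<le> 1 - x"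
  shows "buck_measurable A \<and> buck_measure A = x"
  using assms buck_measure_density_compl_ge[OF assms(1)] by (auto simp: buck_measurable_def)

text \<open>Measurability turns the upper estimate for the complement into the lower estimate for
  \<open>A\<close>.\<close>

lemma buck_measurable_density_tendsto:
  assumes "buck_measurable A"
  shows "(\<lambda>N. real (card (A \<inter> {1..N})) / real N) \<longlonglongrightarrow> buck_measure A"
proof (rule order_tendstoI)
  have A: "A \<subseteq> {1..}" "buck_measure_density ({1..} - A) = 1 - buck_measure_density A"
    using assms by (auto simp: buck_measurable_def)
  show "\<forall>\<^sub>F N in sequentially. real (card (A \<inter> {1..N})) / real N < c"
    if "buck_measure A < c" for c
    using eventually_card_less_buck_measure_density[OF A(1) that] eventually_gt_at_top[of 0]
    by eventually_elim (simp add: divide_less_eq)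
  show "\<forall>\<^sub>F N in sequentially. c < real (card (A \<inter> {1..N})) / real N"
    if "c < buck_measure A" for c
  proof -
    have "\<forall>\<^sub>F N in sequentially. real (card (({1..} - A) \<inter> {1..N})) < (1 - c) * real N"
      using that A(2) by (intro eventually_card_less_buck_measure_density) auto
    then show ?thesis using eventually_gt_at_top[of 0]
    proof eventually_elim
      case (elim N)
      then show ?case using card_Int_add_card_compl[OF A(1), of N]
        by (simp add: less_divide_eq algebra_simps)
    qed
  qed
qed

section \<open>Upper bounds for Buck's density from polyadic continuity\<close>

text \<open>The hypothesis on \<open>E\<close> says that its upper asymptotic density is at most \<open>e\<close>.\<close>

lemma buck_measure_density_le_of_polyadically_continuous:
  assumes "polyadicly_continuous_on ({1..} - B) v" "\<epsilon> > 0" "A \<subseteq> {1..}" "B \<subseteq> {1..}"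
    and E: "\<And>a n. a \<in> A - B \<Longrightarrow> n \<in> {1..} - B \<Longrightarrow> \<bar>v a - v n\<bar> < \<epsilon> \<Longrightarrow> n \<in> E"
    and E_density: "\<And>c. c > e \<Longrightarrow> \<forall>\<^sub>F N in sequentially. real (card (E \<inter> {1..N})) < c * real N"
  shows "buck_measure_density A \<le> e + 2 * buck_measure_density B"
proof -
  obtain m where m: "m \<ge> 1"
    "\<And>a n. a \<in> {1..} - B \<Longrightarrow> n \<in> {1..} - B \<Longrightarrow> [a = n] (mod m) \<Longrightarrow> \<bar>v a - v n\<bar> < \<epsilon>"
    using assms(1,2) unfolding polyadicly_continuous_on_def by meson
  \<comment> \<open>\<open>U\<close> is the union of the residue classes modulo \<open>m\<close>
    that meet \<open>A - B\<close>, and \<open>?q\<close> below is the proportion of these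
    classes.\<close>
  define R where "R = (\<lambda>n. n mod m) ` (A - B)"
  define U where "U = {n \<in> {1..}. n mod m \<in> R}"
  have R: "R \<subseteq> {..<m}" using m(1) by (auto simp: R_def)
  then have "finite R" "card R \<le> m"
    using finite_subset card_mono[of "{..<m}" R] by auto
  have U_sub: "U \<subseteq> E \<union> B"
  proof
    fix n assume "n \<in> U"
    then obtain a where a: "a \<in> A - B" "n mod m = a mod m" and "n \<ge> 1"
      by (auto simp: U_def R_def)
    show "n \<in> E \<union> B"
    proof (cases "n \<in> B")
      case False
      with a \<open>n \<ge> 1\<close> \<open>A \<subseteq> {1..}\<close> have "\<bar>v a - v n\<bar> < \<epsilon>"
        by (intro m(2)) (auto simp: cong_def)
      with E[of a n] a False \<open>n \<ge> 1\<close> show ?thesis by auto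
    qed simp
  qed
  let ?b = "buck_measure_density B" and ?q = "real (card R) / real m"
  \<comment> \<open>This bounds the count of the complement from above, hence the count of
    \<open>U\<close> from below by about \<open>?q * N\<close>.\<close>
  have compl: "buck_measure_density ({1..} - U) \<le> 1 - ?q"
  proof -
    have "buck_measure_density ({1..} - U) \<le> real (card ({..<m} - R)) / real m"
      using m(1) by (intro buck_measure_density_le_residues) (auto simp: U_def)
    also have "\<dots> = 1 - ?q"
      using m(1) R \<open>finite R\<close> \<open>card R \<le> m\<close>
      by (simp add: card_Diff_subset of_nat_diff diff_divide_distrib)
    finally show ?thesis .
  qed
  \<comment> \<open>By \<open>U_sub\<close>, the count of \<open>U\<close> is at most that of
    \<open>E\<close> plus that of \<open>B\<close>. Three asymptotic bounds enter, each with slack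
    \<open>t / 3\<close>.\<close>
  have "?q \<le> e + ?b"
  proof (rule field_le_epsilon)
    fix t :: real assume "t > 0"
    have "\<forall>\<^sub>F N in sequentially. real (card (({1..} - U) \<inter> {1..N})) < (1 - ?q + t / 3) * real N"
      using compl \<open>t > 0\<close> by (intro eventually_card_less_buck_measure_density) auto
    moreover have "\<forall>\<^sub>F N in sequentially. real (card (E \<inter> {1..N})) < (e + t / 3) * real N"
      using \<open>t > 0\<close> by (intro E_density) auto
    moreover have "\<forall>\<^sub>F N in sequentially. real (card (B \<inter> {1..N})) < (?b + t / 3) * real N"
      using \<open>t > 0\<close> \<open>B \<subseteq> {1..}\<close> by (intro eventually_card_less_buck_measure_density) auto
    ultimately have "\<forall>\<^sub>F N in sequentially. ?q \<le> e + ?b + t"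
      using eventually_gt_at_top[of 0]
    proof eventually_elim
      case (elim N)
      have "card (U \<inter> {1..N}) \<le> card ((E \<inter> {1..N}) \<union> (B \<inter> {1..N}))"
        using U_sub by (intro card_mono) auto
      also have "\<dots> \<le> card (E \<inter> {1..N}) + card (B \<inter> {1..N})" by (rule card_Un_le)
      finally have "real (card (U \<inter> {1..N})) \<le> real (card (E \<inter> {1..N})) + real (card (B \<inter> {1..N}))"
        by linarith
      moreover have "real (card (U \<inter> {1..N})) + real (card (({1..} - U) \<inter> {1..N})) = real N"
        by (rule card_Int_add_card_compl) (auto simp: U_def)
      ultimately have "1 * real N
          < (1 - ?q + t / 3) * real N + (e + t / 3) * real N + (?b + t / 3) * real N"
        using elim by linarith
      then have "1 * real N < (1 - ?q + t / 3 + (e + t / 3) + (?b + t / 3)) * real N"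
        by (simp only: distrib_right)
      then have "1 < 1 - ?q + t / 3 + (e + t / 3) + (?b + t / 3)"
        by (simp only: mult_less_cancel_right)
      then show ?case by linarith
    qed
    then show "?q \<le> e + ?b + t" by simp
  qed
  \<comment> \<open>\<open>B\<close> is paid for a second time here, because \<open>U\<close> covers
    only \<open>A - B\<close>; hence the factor 2 in the claim.\<close>
  have "buck_measure_density (U \<union> B) \<le> buck_measure_density U + ?b"
    using \<open>B \<subseteq> {1..}\<close> by (intro buck_measure_density_Un_le) (auto simp: U_def)
  moreover have "buck_measure_density U \<le> ?q"
    using m(1) \<open>finite R\<close> by (intro buck_measure_density_le_residues) (auto simp: U_def)
  moreover have "buck_measure_density A \<le> buck_measure_density (U \<union> B)"
    using assms(3,4) by (intro buck_measure_density_mono) (auto simp: U_def R_def)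
  ultimately show ?thesis using \<open>?q \<le> e + ?b\<close> by linarith
qed

text \<open>Taking both \<open>\<epsilon>\<close> and the bound on the density of \<open>B\<close>
  equal to \<open>t / 3\<close> gives a total error of \<open>t / 3 + 2 * (t / 3) = t\<close>, and
  \<open>t\<close> is arbitrary.\<close>

lemma buck_measure_density_le_of_almost_polyadically_continuous:
  assumes "almost_polyadicly_continuous v" "A \<subseteq> {1..}"
    and E: "\<And>\<epsilon> a n. \<epsilon> > 0 \<Longrightarrow> a \<in> A \<Longrightarrow> n \<ge> 1 \<Longrightarrow> \<bar>v a - v n\<bar> < \<epsilon> \<Longrightarrow> n \<in> E \<epsilon>"
    and E_density: "\<And>\<epsilon> c. \<epsilon> > 0 \<Longrightarrow> c > e + \<epsilon> \<Longrightarrow>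
      \<forall>\<^sub>F N in sequentially. real (card (E \<epsilon> \<inter> {1..N})) < c * real N"
  shows "buck_measure_density A \<le> e"
proof (rule field_le_epsilon)
  fix t :: real assume "t > 0"
  then obtain B where B: "B \<subseteq> {1..}" "buck_measure_density B \<le> t / 3"
    "polyadicly_continuous_on ({1..} - B) v"
    using assms(1) unfolding almost_polyadicly_continuous_def buck_measurable_def
    by (meson divide_pos_pos zero_less_numeral)
  have "buck_measure_density A \<le> (e + t / 3) + 2 * buck_measure_density B"
    using E[of "t / 3"] E_density[of "t / 3"] \<open>t > 0\<close>
    by (intro buck_measure_density_le_of_polyadically_continuous
        [OF B(3) _ assms(2) B(1), where \<epsilon> = "t / 3" and E = "E (t / 3)"]) auto
  with B(2) show "buck_measure_density A \<le> e + t" by linarith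
qed

section \<open>Counting bounds from uniform distribution, and the equivalence\<close>

text \<open>Handles the shifted thresholds \<open>x + \<epsilon>\<close> and
  \<open>x - \<epsilon>\<close> that leave the unit interval, where uniform distribution says
  nothing.\<close>

lemma eventually_card_less_of_gt_1:
  assumes "c > 1"
  shows "\<forall>\<^sub>F N in sequentially. real (card (A \<inter> {1..N})) < c * real N"
  using eventually_gt_at_top[of 0]
proof eventually_elim
  case (elim N)
  have "card (A \<inter> {1..N}) \<le> card {1..N}" by (rule card_mono) auto
  then have "real (card (A \<inter> {1..N})) \<le> 1 * real N" by simp
  also have "\<dots> < c * real N" using assms elim by (intro mult_strict_right_mono) auto
  finally show ?case .
qed

lemma uniformly_distributed_eventually_card_less:
  assumes "uniformly_distributed v" "0 \<le> y" "y < c"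
  shows "\<forall>\<^sub>F N in sequentially. real (card ({n \<in> {1..}. v n < y} \<inter> {1..N})) < c * real N"
proof (cases "y \<le> 1")
  case True
  then have "(\<lambda>N. real (card {n \<in> {1..N}. v n < y}) / real N) \<longlonglongrightarrow> y"
    using assms by (simp add: uniformly_distributed_def)
  from order_tendstoD(2)[OF this \<open>y < c\<close>] show ?thesis using eventually_gt_at_top[of 0]
  proof eventually_elim
    case (elim N)
    have "{n \<in> {1..}. v n < y} \<inter> {1..N} = {n \<in> {1..N}. v n < y}" by auto
    with elim show ?case by (simp add: divide_less_eq)
  qed
next
  case False
  with assms show ?thesis by (intro eventually_card_less_of_gt_1) linarith
qed

lemma uniformly_distributed_eventually_card_ge_less:
  assumes "uniformly_distributed v" "y \<le> 1" "1 - y < c"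
  shows "\<forall>\<^sub>F N in sequentially. real (card ({n \<in> {1..}. v n \<ge> y} \<inter> {1..N})) < c * real N"
proof (cases "0 \<le> y")
  case True
  then have "(\<lambda>N. real (card {n \<in> {1..N}. v n < y}) / real N) \<longlonglongrightarrow> y"
    using assms by (simp add: uniformly_distributed_def)
  \<comment> \<open>A lower bound \<open>1 - c\<close> for the proportion of \<open>v n < y\<close>
    is an upper bound \<open>c\<close> for that of \<open>v n \<ge> y\<close>.\<close>
  moreover have "1 - c < y" using assms(3) by simp
  ultimately have "\<forall>\<^sub>F N in sequentially. 1 - c < real (card {n \<in> {1..N}. v n < y}) / real N"
    by (rule order_tendstoD(1))
  then show ?thesis using eventually_gt_at_top[of 0]
  proof eventually_elim
    case (elim N)
    have "{n \<in> {1..}. v n < y} \<inter> {1..N} = {n \<in> {1..N}. v n < y}"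
      "{1..} - {n \<in> {1..}. v n < y} = {n \<in> {1..}. v n \<ge> y}" by auto
    moreover have "{n \<in> {1..}. v n < y} \<subseteq> {1..}" by auto
    ultimately show ?case using card_Int_add_card_compl[of "{n \<in> {1..}. v n < y}" N] elim
      by (simp add: less_divide_eq algebra_simps)
  qed
next
  case False
  with assms show ?thesis by (intro eventually_card_less_of_gt_1) linarith
qed

theorem theorem4:
  fixes v :: "nat \<Rightarrow> real"
  assumes "\<And>n. n \<ge> 1 \<Longrightarrow> v n \<in> {0..1}"
    and "almost_polyadicly_continuous v"
  shows "buck_uniformly_distributed v \<longleftrightarrow> uniformly_distributed v"
proof
  assume buck: "buck_uniformly_distributed v"
  show "uniformly_distributed v"
    unfolding uniformly_distributed_def
  proof
    fix x :: real assume "x \<in> {0..1}"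
    with buck have "(\<lambda>N. real (card ({n \<in> {1..}. v n < x} \<inter> {1..N})) / real N) \<longlonglongrightarrow> x"
      using buck_measurable_density_tendsto[of "{n \<in> {1..}. v n < x}"]
      by (simp add: buck_uniformly_distributed_def)
    moreover have "{n \<in> {1..}. v n < x} \<inter> {1..N} = {n \<in> {1..N}. v n < x}" for N by auto
    ultimately show "(\<lambda>N. real (card {n \<in> {1..N}. v n < x}) / real N) \<longlonglongrightarrow> x" by simp
  qed
next
  assume ud: "uniformly_distributed v"
  show "buck_uniformly_distributed v"
    unfolding buck_uniformly_distributed_def
  proof (intro ballI buck_measure_density_eqI)
    fix x :: real assume x: "x \<in> {0..1}"
    \<comment> \<open>Moving a value below \<open>x\<close> by less than \<open>\<epsilon>\<close>
      keeps it below \<open>x + \<epsilon>\<close>; this dictates the choice of \<open>E\<close>.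
      The complement uses \<open>x - \<epsilon>\<close> symmetrically.\<close>
    show "buck_measure_density {n \<in> {1..}. v n < x} \<le> x"
      by (rule buck_measure_density_le_of_almost_polyadically_continuous
          [OF assms(2), where E = "\<lambda>\<epsilon>. {n \<in> {1..}. v n < x + \<epsilon>}"])
        (use x in \<open>auto intro!: uniformly_distributed_eventually_card_less[OF ud, simplified]\<close>)
    show "buck_measure_density ({1..} - {n \<in> {1..}. v n < x}) \<le> 1 - x"
      by (rule buck_measure_density_le_of_almost_polyadically_continuous
          [OF assms(2), where E = "\<lambda>\<epsilon>. {n \<in> {1..}. v n \<ge> x - \<epsilon>}"])
        (use x in \<open>auto intro!: uniformly_distributed_eventually_card_ge_less[OF ud, simplified]\<close>)
  qed auto
qed

end
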